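(* Let $G$ be a graph and let $k\ge 1$ be an integer. Then $G$ is a $k$-median graph if and only if $G$ is connected, bipartite and there are $k$ (distinct) vertices $\mu_1,\dots,\mu_k\in V(G)$ such that $G$ satisfies (C0) and (C2) w.r.t. each of $\mu_1,\dots,\mu_k$. In this case (i.e. whenever $G$ is connected, bipartite and satisfies (C0) and (C2) w.r.t. $\mu_1,\dots,\mu_k$), the vertices $\mu_1,\dots,\mu_k$ are median-consistent vertices of $G$.
   Context: All graphs are finite, simple and undirected. A graph is bipartite if its vertex set can be partitioned into two (possibly empty) sets such that every edge joins the two sets. For $x,y\in V(G)$, the interval $I_G(x,y)$ is the set of all vertices lying on shortest $(x,y)$-paths in $G$ (it is empty if $x,y$ lie in different connected components), and $I_G(x,y,z):=I_G(x,y)\cap I_G(x,z)\cap I_G(y,z)$. A vertex $\mu\in V(G)$ is median-consistent in $G$ if $|I_G(\mu,x,y)|=1$ for all $x,y\in V(G)$. A graph is a $k$-median graph ($k\geq 1$) if it has (at least) $k$ median-consistent vertices. For $W\subseteq V(G)$, $G[W]$ denotes the subgraph induced by $W$. For $u\in V(G)$: $G$ satisfies (C0) w.r.t. $u$ if, for all $v,w\in V(G)$, $I_G(u,v)\cap I_G(v,w)=\{v\}$ implies $v\in I_G(u,w)$; $G$ satisfies (C2) w.r.t. $u$ if, for all $v,w\in V(G)$, $G[I_G(u,v,w)]$ contains an edge whenever it contains more than one vertex. *)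

theory Defs
  imports "Graph_Theory.Graph_Theory"
begin

text \<open>
  Finite simple undirected graphs are the loop-free, multi-arc-free finite symmetric digraphs of
  the locale \<^locale>\<open>graph\<close>: an undirected edge is a pair of opposite arcs. The length of a path
  is its number of arcs.
\<close>

definition bipartite :: "('a, 'b) pre_digraph \<Rightarrow> bool" where
  "bipartite G \<longleftrightarrow> (\<exists>A B. A \<union> B = verts G \<and> A \<inter> B = {} \<and>
     (\<forall>e \<in> arcs G. (tail G e \<in> A \<and> head G e \<in> B) \<or> (tail G e \<in> B \<and> head G e \<in> A)))"

definition shortest_path :: "('a, 'b) pre_digraph \<Rightarrow> 'a \<Rightarrow> 'b awalk \<Rightarrow> 'a \<Rightarrow> bool" where
  "shortest_path G x p y \<longleftrightarrow> pre_digraph.apath G x p y \<and>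
     (\<forall>q. pre_digraph.apath G x q y \<longrightarrow> length p \<le> length q)"

definition interval :: "('a, 'b) pre_digraph \<Rightarrow> 'a \<Rightarrow> 'a \<Rightarrow> 'a set" where
  "interval G x y = {w. \<exists>p. shortest_path G x p y \<and> w \<in> set (pre_digraph.awalk_verts G x p)}"

definition interval3 :: "('a, 'b) pre_digraph \<Rightarrow> 'a \<Rightarrow> 'a \<Rightarrow> 'a \<Rightarrow> 'a set" where
  "interval3 G x y z = interval G x y \<inter> interval G x z \<inter> interval G y z"

definition median_consistent :: "('a, 'b) pre_digraph \<Rightarrow> 'a \<Rightarrow> bool" where
  "median_consistent G \<mu> \<longleftrightarrow> \<mu> \<in> verts G \<and>
     (\<forall>x \<in> verts G. \<forall>y \<in> verts G. card (interval3 G \<mu> x y) = 1)"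

definition k_median_graph :: "nat \<Rightarrow> ('a, 'b) pre_digraph \<Rightarrow> bool" where
  "k_median_graph k G \<longleftrightarrow> k \<le> card {\<mu> \<in> verts G. median_consistent G \<mu>}"

definition C0 :: "('a, 'b) pre_digraph \<Rightarrow> 'a \<Rightarrow> bool" where
  "C0 G u \<longleftrightarrow> (\<forall>v \<in> verts G. \<forall>w \<in> verts G.
     interval G u v \<inter> interval G v w = {v} \<longrightarrow> v \<in> interval G u w)"

definition C2 :: "('a, 'b) pre_digraph \<Rightarrow> 'a \<Rightarrow> bool" where
  "C2 G u \<longleftrightarrow> (\<forall>v \<in> verts G. \<forall>w \<in> verts G.
     card (verts (G \<restriction> interval3 G u v w)) > 1 \<longrightarrow> arcs (G \<restriction> interval3 G u v w) \<noteq> {})"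

end

theory Submission
  imports Defs
begin

text \<open>
  Everything is expressed through the distance \<open>d\<close>: in a connected graph \<open>w\<close> lies in \<open>I(x, y)\<close> iff
  \<open>d(x, w) + d(w, y) = d(x, y)\<close>. Fix \<open>u\<close>. If \<open>u\<close> is median-consistent then (C0) and (C2) are immediate,
  and an edge \<open>ab\<close> with \<open>d(u, a) = d(u, b)\<close> would make \<open>I(u, a, b)\<close> empty, so the parity of the
  distance to \<open>u\<close> is a bipartition. Conversely, the vertex of \<open>I(u, v) \<inter> I(v, w)\<close> closest to \<open>u\<close> lies
  in \<open>I(u, w)\<close> by (C0), so \<open>I(u, v, w)\<close> is nonempty. If it had two vertices, (C2) would give an edge
  \<open>ab\<close> inside it, and bipartiteness allows us to assume \<open>d(u, b) = d(u, a) + 1\<close>; then \<open>b\<close> is closer than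
  \<open>a\<close> to both \<open>v\<close> and \<open>w\<close>, although both vertices lie on shortest paths from \<open>v\<close> to \<open>w\<close>.
\<close>

section \<open>Distance and shortest walks\<close>

text \<open>Minimising over walks rather than paths lets concatenated walks bound distances without
  any distinctness condition. For an unreachable pair the value carries no information.\<close>

definition graph_dist :: "('a, 'b) pre_digraph \<Rightarrow> 'a \<Rightarrow> 'a \<Rightarrow> nat" where
  "graph_dist G x y = (LEAST n. \<exists>p. pre_digraph.awalk G x p y \<and> length p = n)"

lemma (in wf_digraph) graph_dist_le_length:
  assumes "awalk x p y"
  shows "graph_dist G x y \<le> length p"
  unfolding graph_dist_def using assms by (blast intro: Least_le)

lemma (in wf_digraph) graph_dist_awalk_exists:
  assumes "x \<rightarrow>\<^sup>* y"
  obtains p where "awalk x p y" "length p = graph_dist G x y"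
proof -
  have "\<exists>n p. awalk x p y \<and> length p = n"
    using assms by (simp add: reachable_awalk)
  from LeastI_ex[OF this] show ?thesis
    using that unfolding graph_dist_def by blast
qed

text \<open>A repeated vertex would give a nonempty closed subwalk; cutting it out leaves a shorter
  walk with the same ends.\<close>

lemma (in wf_digraph) apath_if_length_eq_graph_dist:
  assumes "awalk x p y" "length p = graph_dist G x y"
  shows "apath x p y"
proof (rule ccontr)
  assume "\<not> apath x p y"
  with assms have "\<not> distinct (awalk_verts x p)" by (simp add: apath_def)
  from awalk_not_distinct_decomp[OF assms(1) this]
  obtain q r s w where qrs: "p = q @ r @ s" "0 < length r" "awalk x q w" "awalk w s y"
    by blast
  then have "graph_dist G x y \<le> length (q @ s)"
    by (blast intro: graph_dist_le_length awalk_appendI)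
  moreover have "length (q @ s) < length p" using qrs(1,2) by simp
  ultimately show False using assms(2) by simp
qed

lemma (in wf_digraph) shortest_path_iff:
  "shortest_path G x p y \<longleftrightarrow> awalk x p y \<and> length p = graph_dist G x y"
proof
  assume sp: "shortest_path G x p y"
  then have p: "awalk x p y" by (simp add: shortest_path_def awalkI_apath)
  then obtain q where q: "awalk x q y" "length q = graph_dist G x y"
    using graph_dist_awalk_exists reachable_awalk by blast
  with sp have "length p \<le> length q"
    unfolding shortest_path_def by (blast intro: apath_if_length_eq_graph_dist)
  with p q graph_dist_le_length[OF p] show "awalk x p y \<and> length p = graph_dist G x y" by simp
next
  assume p: "awalk x p y \<and> length p = graph_dist G x y"
  then have "apath x p y" by (simp add: apath_if_length_eq_graph_dist)
  moreover have "length p \<le> length q" if "apath x q y" for q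
    using p graph_dist_le_length[OF awalkI_apath[OF that]] by simp
  ultimately show "shortest_path G x p y" by (simp add: shortest_path_def)
qed

text \<open>Connectedness is not assumed here because this fact serves to derive it from
  median-consistency.\<close>

lemma (in wf_digraph) reachable_if_mem_interval:
  assumes "w \<in> interval G x y"
  shows "x \<rightarrow>\<^sup>* w"
proof -
  from assms obtain p where "awalk x p y" "w \<in> set (awalk_verts x p)"
    by (auto simp: interval_def shortest_path_iff)
  then obtain q where "awalk x q w" using awalk_decomp by blast
  then show ?thesis by (rule reachable_awalkI)
qed

section \<open>Reversal and parity of walks\<close>

lemma (in sym_digraph) awalk_rev_exists:
  assumes "awalk x p y"
  shows "\<exists>q. awalk y q x \<and> length q = length p"
  using assms
proof (induction p arbitrary: x)
  case Nil
  then show ?case by (auto simp: awalk_Nil_iff)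
next
  case (Cons e p)
  then obtain q where q: "awalk y q (head G e)" "length q = length p"
    by (auto simp: awalk_Cons_iff)
  obtain e' where "e' \<in> arcs G" "tail G e' = head G e" "head G e' = tail G e"
    using Cons.prems sym_arcs by (metis awalk_Cons_iff symmetric_conv)
  then have "awalk (head G e) [e'] x"
    using Cons.prems arc_implies_awalk by (metis awalk_Cons_iff)
  with q(1) have "awalk y (q @ [e']) x" by (rule awalk_appendI)
  with q(2) show ?case by (intro exI[of _ "q @ [e']"]) simp
qed

lemma (in sym_digraph) graph_dist_commute: "graph_dist G x y = graph_dist G y x"
  unfolding graph_dist_def by (metis awalk_rev_exists)

text \<open>Every arc crosses between \<open>A\<close> and \<open>B\<close>, so each step of the
  walk flips membership in \<open>A\<close>.\<close>

lemma (in wf_digraph) awalk_even_length_iff: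
  assumes "awalk x p y" "A \<inter> B = {}"
    and "\<And>e. e \<in> arcs G \<Longrightarrow>
      (tail G e \<in> A \<and> head G e \<in> B) \<or> (tail G e \<in> B \<and> head G e \<in> A)"
  shows "even (length p) \<longleftrightarrow> (x \<in> A \<longleftrightarrow> y \<in> A)"
  using assms(1)
proof (induction p arbitrary: x)
  case Nil
  then show ?case by (simp add: awalk_Nil_iff)
next
  case (Cons e p)
  then have e: "e \<in> arcs G" "x = tail G e" and p: "awalk (head G e) p y"
    by (simp_all add: awalk_Cons_iff)
  have "x \<in> A \<longleftrightarrow> head G e \<notin> A" using assms(2) assms(3)[OF e(1)] e(2) by blast
  then show ?case using Cons.IH[OF p] by auto
qed

section \<open>The metric and the intervals of a connected graph\<close>

locale connected_graph = graph +
  assumes connected: "connected G"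
begin

lemma reachable:
  assumes "x \<in> verts G" "y \<in> verts G"
  shows "x \<rightarrow>\<^sup>* y"
  using symmetric_connected_imp_strongly_connected[OF sym_arcs connected] assms
  by (simp add: strongly_connected_def)

lemma graph_dist_triangle:
  assumes "x \<in> verts G" "y \<in> verts G" "z \<in> verts G"
  shows "graph_dist G x z \<le> graph_dist G x y + graph_dist G y z"
proof -
  obtain p where p: "awalk x p y" "length p = graph_dist G x y"
    by (rule graph_dist_awalk_exists[OF reachable[OF assms(1,2)]])
  obtain q where q: "awalk y q z" "length q = graph_dist G y z"
    by (rule graph_dist_awalk_exists[OF reachable[OF assms(2,3)]])
  from graph_dist_le_length[OF awalk_appendI[OF p(1) q(1)]] p(2) q(2) show ?thesis by simp
qed

lemma graph_dist_eq_0_iff: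
  assumes "x \<in> verts G" "y \<in> verts G"
  shows "graph_dist G x y = 0 \<longleftrightarrow> x = y"
proof
  assume "graph_dist G x y = 0"
  moreover obtain p where "awalk x p y" "length p = graph_dist G x y"
    by (rule graph_dist_awalk_exists[OF reachable[OF assms]])
  ultimately show "x = y" by (simp add: awalk_Nil_iff)
next
  assume "x = y"
  then show "graph_dist G x y = 0"
    using graph_dist_le_length[of x "[]" x] assms by (simp add: awalk_Nil_iff)
qed

lemma graph_dist_arc:
  assumes "e \<in> arcs G"
  shows "graph_dist G (tail G e) (head G e) = 1"
proof -
  have "graph_dist G (tail G e) (head G e) \<noteq> 0"
    using assms no_loops by (simp add: graph_dist_eq_0_iff)
  moreover have "graph_dist G (tail G e) (head G e) \<le> 1"
    using graph_dist_le_length[OF arc_implies_awalk[OF assms]] by simp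
  ultimately show ?thesis by linarith
qed

lemma graph_dist_arc_le:
  assumes "e \<in> arcs G" "u \<in> verts G"
  shows "graph_dist G u (head G e) \<le> graph_dist G u (tail G e) + 1"
    and "graph_dist G u (tail G e) \<le> graph_dist G u (head G e) + 1"
proof -
  have verts: "tail G e \<in> verts G" "head G e \<in> verts G" using assms(1) by simp_all
  show "graph_dist G u (head G e) \<le> graph_dist G u (tail G e) + 1"
    using graph_dist_triangle[OF assms(2) verts] graph_dist_arc[OF assms(1)] by linarith
  show "graph_dist G u (tail G e) \<le> graph_dist G u (head G e) + 1"
    using graph_dist_triangle[OF assms(2) verts(2,1)] graph_dist_arc[OF assms(1)]
      graph_dist_commute[of "head G e" "tail G e"] by linarith
qed

text \<open>A shortest walk split at \<open>w\<close> bounds both distances from above, and the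
  triangle inequality forces equality. Conversely, shortest walks to and from \<open>w\<close>
  concatenate to a walk of minimal length.\<close>

lemma mem_interval_iff:
  assumes "x \<in> verts G" "y \<in> verts G"
  shows "w \<in> interval G x y \<longleftrightarrow>
    w \<in> verts G \<and> graph_dist G x w + graph_dist G w y = graph_dist G x y"
proof
  assume "w \<in> interval G x y"
  then obtain p where p: "awalk x p y" "length p = graph_dist G x y" "w \<in> set (awalk_verts x p)"
    by (auto simp: interval_def shortest_path_iff)
  then obtain q r where qr: "p = q @ r" "awalk x q w" "awalk w r y"
    using awalk_decomp by blast
  have "w \<in> verts G" using qr(3) by (rule awalk_hd_in_verts)
  then show "w \<in> verts G \<and> graph_dist G x w + graph_dist G w y = graph_dist G x y"
    using graph_dist_le_length[OF qr(2)] graph_dist_le_length[OF qr(3)]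
      graph_dist_triangle[OF assms(1) _ assms(2), of w] p(2) qr(1)
    by simp
next
  assume w: "w \<in> verts G \<and> graph_dist G x w + graph_dist G w y = graph_dist G x y"
  obtain q where q: "awalk x q w" "length q = graph_dist G x w"
    using w assms(1) by (blast intro: graph_dist_awalk_exists reachable)
  obtain r where r: "awalk w r y" "length r = graph_dist G w y"
    using w assms(2) by (blast intro: graph_dist_awalk_exists reachable)
  have "awalk x (q @ r) y" using q(1) r(1) by (rule awalk_appendI)
  then have "shortest_path G x (q @ r) y"
    unfolding shortest_path_iff using w q(2) r(2) by simp
  moreover have "w \<in> set (awalk_verts x (q @ r))"
    using set_awalk_verts_append[OF q(1) r(1)] hd_in_awalk_verts(1)[OF r(1)] by simp
  ultimately show "w \<in> interval G x y" unfolding interval_def by blast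
qed

lemma interval_subset_verts:
  assumes "x \<in> verts G" "y \<in> verts G"
  shows "interval G x y \<subseteq> verts G"
  using assms by (auto simp: mem_interval_iff)

section \<open>Bipartiteness as parity of distance\<close>

lemma graph_dist_arc_neq_if_bipartite:
  assumes "bipartite G" "e \<in> arcs G" "u \<in> verts G"
  shows "graph_dist G u (tail G e) \<noteq> graph_dist G u (head G e)"
proof -
  obtain A B where AB: "A \<inter> B = {}" "\<And>e. e \<in> arcs G \<Longrightarrow>
      (tail G e \<in> A \<and> head G e \<in> B) \<or> (tail G e \<in> B \<and> head G e \<in> A)"
    using assms(1) unfolding bipartite_def by (elim exE conjE) simp
  have even_iff: "even (graph_dist G u x) \<longleftrightarrow> (u \<in> A \<longleftrightarrow> x \<in> A)" if x: "x \<in> verts G" for x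
  proof -
    obtain p where p: "awalk u p x" "length p = graph_dist G u x"
      by (rule graph_dist_awalk_exists[OF reachable[OF assms(3) x]])
    show ?thesis using awalk_even_length_iff[OF p(1) AB] unfolding p(2) .
  qed
  have "tail G e \<in> A \<longleftrightarrow> head G e \<notin> A" using AB(1) AB(2)[OF assms(2)] by blast
  then have "even (graph_dist G u (tail G e)) \<noteq> even (graph_dist G u (head G e))"
    using even_iff assms(2) by simp
  then show ?thesis by metis
qed

text \<open>Distances to \<open>u\<close> differ by at most one along an arc, so unequal ones have
  opposite parity; the even and odd distance classes are the two sides.\<close>

lemma bipartite_if_graph_dist_arc_neq:
  assumes "u \<in> verts G"
    and "\<And>e. e \<in> arcs G \<Longrightarrow> graph_dist G u (tail G e) \<noteq> graph_dist G u (head G e)"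
  shows "bipartite G"
proof -
  have "even (graph_dist G u (tail G e)) \<longleftrightarrow> odd (graph_dist G u (head G e))" if "e \<in> arcs G" for e
  proof -
    have "graph_dist G u (head G e) = Suc (graph_dist G u (tail G e)) \<or>
        graph_dist G u (tail G e) = Suc (graph_dist G u (head G e))"
      using graph_dist_arc_le[OF that assms(1)] assms(2)[OF that] by linarith
    then show ?thesis by auto
  qed
  then show ?thesis
    unfolding bipartite_def
    by (intro exI[of _ "{x \<in> verts G. even (graph_dist G u x)}"]
        exI[of _ "{x \<in> verts G. odd (graph_dist G u x)}"]) auto
qed

section \<open>From (C0) and (C2) to median-consistency\<close>

lemma interval3_nonempty_if_C0:
  assumes C0: "C0 G u" and verts: "u \<in> verts G" "v \<in> verts G" "w \<in> verts G"
  shows "interval3 G u v w \<noteq> {}"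
proof -
  let ?S = "interval G u v \<inter> interval G v w"
  have "v \<in> ?S"
    using verts by (simp add: mem_interval_iff graph_dist_eq_0_iff)
  then obtain x where x: "x \<in> ?S" and closest: "\<And>y. y \<in> ?S \<Longrightarrow> graph_dist G u x \<le> graph_dist G u y"
    using ex_has_least_nat[of "\<lambda>x. x \<in> ?S" v "graph_dist G u"] by auto
  have x_verts: "x \<in> verts G" using x interval_subset_verts[OF verts(1,2)] by blast
  \<comment> \<open>This is the premise of (C0) for the pair \<open>x\<close>, \<open>w\<close>:
    such a \<open>y\<close> belongs to \<open>?S\<close> again, and being on the way from
    \<open>u\<close> to \<open>x\<close> it contradicts the choice of \<open>x\<close> unless it
    equals \<open>x\<close>.\<close>
  have "y = x" if y: "y \<in> interval G u x \<inter> interval G x w" for y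
  proof -
    have y_verts: "y \<in> verts G" using y interval_subset_verts[OF verts(1) x_verts] by blast
    have uyx: "graph_dist G u y + graph_dist G y x = graph_dist G u x"
      and xyw: "graph_dist G x y + graph_dist G y w = graph_dist G x w"
      using y verts x_verts by (auto simp: mem_interval_iff)
    have uxv: "graph_dist G u x + graph_dist G x v = graph_dist G u v"
      and vxw: "graph_dist G v x + graph_dist G x w = graph_dist G v w"
      using x verts by (auto simp: mem_interval_iff)
    \<comment> \<open>Going from \<open>y\<close> to \<open>v\<close> through \<open>x\<close>, and
      from \<open>v\<close> to \<open>y\<close> through \<open>x\<close>, costs no extra
      length.\<close>
    have "graph_dist G u y + graph_dist G y v = graph_dist G u v"
      using uyx uxv graph_dist_triangle[OF y_verts x_verts verts(2)]
        graph_dist_triangle[OF verts(1) y_verts verts(2)] by linarith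
    moreover have "graph_dist G v y + graph_dist G y w = graph_dist G v w"
      using xyw vxw graph_dist_triangle[OF verts(2) x_verts y_verts]
        graph_dist_triangle[OF verts(2) y_verts verts(3)] by linarith
    ultimately have "y \<in> ?S"
      using verts y_verts by (simp add: mem_interval_iff)
    then have "graph_dist G u x \<le> graph_dist G u y" by (rule closest)
    with uyx have "graph_dist G y x = 0" by linarith
    then show ?thesis using y_verts x_verts graph_dist_eq_0_iff by blast
  qed
  moreover have "x \<in> interval G u x \<inter> interval G x w"
    using verts x_verts by (simp add: mem_interval_iff graph_dist_eq_0_iff)
  ultimately have "interval G u x \<inter> interval G x w = {x}"
    by (intro equalityI subsetI) simp_all
  then have "x \<in> interval G u w" using C0 verts x_verts by (simp add: C0_def)
  with x show ?thesis unfolding interval3_def by blast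
qed

text \<open>Since \<open>card\<close> of an infinite set is 0, finiteness is what turns nonemptiness
  into nonzero cardinality.\<close>

lemma finite_interval3:
  assumes "u \<in> verts G" "v \<in> verts G" "w \<in> verts G"
  shows "finite (interval3 G u v w)"
  by (rule finite_subset[OF _ finite_verts])
    (use assms interval_subset_verts in \<open>auto simp: interval3_def\<close>)

lemma no_arc_in_interval3_if_bipartite:
  assumes "bipartite G" and verts: "u \<in> verts G" "v \<in> verts G" "w \<in> verts G"
  shows "arcs (G \<restriction> interval3 G u v w) = {}"
proof -
  \<comment> \<open>Stated for an ordered pair, so that it covers both directions of an arc. The
    step from \<open>a\<close> to \<open>b\<close> lowers the distances to \<open>v\<close> and
    \<open>w\<close> by one each, yet their sum is the distance from \<open>v\<close> to
    \<open>w\<close> at both vertices.\<close>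
  have False
    if a: "a \<in> interval3 G u v w" and b: "b \<in> interval3 G u v w"
      and closer: "graph_dist G u b = graph_dist G u a + 1"
    for a b
  proof -
    have "graph_dist G u a + graph_dist G a v = graph_dist G u v"
      "graph_dist G u a + graph_dist G a w = graph_dist G u w"
      "graph_dist G v a + graph_dist G a w = graph_dist G v w"
      using a verts by (simp_all add: interval3_def mem_interval_iff)
    moreover have "graph_dist G u b + graph_dist G b v = graph_dist G u v"
      "graph_dist G u b + graph_dist G b w = graph_dist G u w"
      "graph_dist G v b + graph_dist G b w = graph_dist G v w"
      using b verts by (simp_all add: interval3_def mem_interval_iff)
    ultimately show False
      using closer graph_dist_commute[of v a] graph_dist_commute[of v b] by linarith
  qed
  moreover have "graph_dist G u (head G e) = graph_dist G u (tail G e) + 1 \<or>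
      graph_dist G u (tail G e) = graph_dist G u (head G e) + 1" if "e \<in> arcs G" for e
    using graph_dist_arc_neq_if_bipartite[OF assms(1) that verts(1)]
      graph_dist_arc_le[OF that verts(1)] by linarith
  ultimately show ?thesis unfolding induce_subgraph_def by (simp, blast)
qed

lemma median_consistent_if_C0_C2:
  assumes "bipartite G" "u \<in> verts G" "C0 G u" "C2 G u"
  shows "median_consistent G u"
  unfolding median_consistent_def
proof (intro conjI ballI)
  fix v w assume verts: "v \<in> verts G" "w \<in> verts G"
  have "card (interval3 G u v w) \<noteq> 0"
    using assms verts interval3_nonempty_if_C0 finite_interval3 by simp
  moreover have "\<not> card (interval3 G u v w) > 1"
    using assms verts no_arc_in_interval3_if_bipartite[of u v w] unfolding C2_def by auto
  ultimately show "card (interval3 G u v w) = 1" by simp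
qed fact

section \<open>Consequences of median-consistency\<close>

text \<open>If both ends of an arc were equally far from \<open>u\<close>, a vertex of their common
  interval with \<open>u\<close> would be equally far from both ends, but these two distances sum to
  1.\<close>

lemma bipartite_if_median_consistent:
  assumes "median_consistent G u"
  shows "bipartite G"
proof (rule bipartite_if_graph_dist_arc_neq)
  show u: "u \<in> verts G" using assms by (simp add: median_consistent_def)
  fix e assume e: "e \<in> arcs G"
  let ?a = "tail G e" and ?b = "head G e"
  have "interval3 G u ?a ?b \<noteq> {}"
    using assms e unfolding median_consistent_def
    by (metis card.empty head_in_verts tail_in_verts zero_neq_one)
  then obtain x where x: "x \<in> interval3 G u ?a ?b" by blast
  have verts: "?a \<in> verts G" "?b \<in> verts G" using e by simp_all
  then have ab: "graph_dist G ?a x + graph_dist G x ?b = 1"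
    and ua: "graph_dist G u x + graph_dist G x ?a = graph_dist G u ?a"
    and ub: "graph_dist G u x + graph_dist G x ?b = graph_dist G u ?b"
    using x u graph_dist_arc[OF e] by (auto simp: interval3_def mem_interval_iff)
  show "graph_dist G u ?a \<noteq> graph_dist G u ?b"
  proof
    assume "graph_dist G u ?a = graph_dist G u ?b"
    then have "2 * graph_dist G x ?b = 1"
      using ab ua ub graph_dist_commute[of ?a x] by linarith
    then show False by simp
  qed
qed

end

text \<open>A vertex of \<open>interval3 G u v w\<close> lies in the intersection assumed to be
  \<open>{v}\<close>, so it is \<open>v\<close> itself.\<close>

lemma C0_if_median_consistent:
  assumes "median_consistent G u"
  shows "C0 G u"
  unfolding C0_def
proof (intro ballI impI)
  fix v w assume "v \<in> verts G" "w \<in> verts G" and v: "interval G u v \<inter> interval G v w = {v}"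
  with assms have "interval3 G u v w \<noteq> {}"
    unfolding median_consistent_def by (metis card.empty zero_neq_one)
  then obtain x where "x \<in> interval G u v \<inter> interval G v w" "x \<in> interval G u w"
    unfolding interval3_def by auto
  with v show "v \<in> interval G u w" by simp
qed

text \<open>The triple interval has exactly one vertex, so the condition holds vacuously.\<close>

lemma C2_if_median_consistent:
  assumes "median_consistent G u"
  shows "C2 G u"
  using assms by (simp add: median_consistent_def C2_def)

lemma (in graph) connected_if_median_consistent:
  assumes "median_consistent G u"
  shows "connected G"
proof -
  have reach: "u \<rightarrow>\<^sup>* x" if "x \<in> verts G" for x
  proof -
    \<comment> \<open>Repeating \<open>x\<close> yields a vertex reachable from both
      \<open>u\<close> and \<open>x\<close>; reversing the second walk joins \<open>u\<close> to
      \<open>x\<close>.\<close>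
    have "interval3 G u x x \<noteq> {}"
      using assms that unfolding median_consistent_def by (metis card.empty zero_neq_one)
    then obtain w where "w \<in> interval G u x" "w \<in> interval G x x"
      unfolding interval3_def by blast
    then have "u \<rightarrow>\<^sup>* w" "x \<rightarrow>\<^sup>* w" by (auto intro: reachable_if_mem_interval)
    then show ?thesis
      using awalk_rev_exists reachable_trans by (metis reachable_awalk)
  qed
  have "x \<rightarrow>\<^sup>* y" if "x \<in> verts G" "y \<in> verts G" for x y
    using reach[OF that(1)] reach[OF that(2)] awalk_rev_exists reachable_trans
    by (metis reachable_awalk)
  \<comment> \<open>Strong connectedness also requires a nonempty vertex set, which \<open>u\<close>
    witnesses.\<close>
  then have "strongly_connected (mk_symmetric G)"
    unfolding strongly_connected_def
    using assms reachable_mk_symmetricI by (auto simp: median_consistent_def)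
  then show ?thesis by (simp add: connected_def)
qed

section \<open>The equivalence for k vertices\<close>

theorem mainTheorem3:
  fixes G :: "('a, 'b) pre_digraph" and k :: nat
  assumes "graph G" and "k \<ge> 1"
  shows "(k_median_graph k G \<longleftrightarrow>
      connected G \<and> bipartite G \<and>
      (\<exists>\<mu> :: nat \<Rightarrow> 'a. inj_on \<mu> {1..k} \<and>
        (\<forall>i \<in> {1..k}. \<mu> i \<in> verts G \<and> C0 G (\<mu> i) \<and> C2 G (\<mu> i)))) \<and>
    (\<forall>\<mu> :: nat \<Rightarrow> 'a.
      connected G \<and> bipartite G \<and> inj_on \<mu> {1..k} \<and>
      (\<forall>i \<in> {1..k}. \<mu> i \<in> verts G \<and> C0 G (\<mu> i) \<and> C2 G (\<mu> i)) \<longrightarrow>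
      (\<forall>i \<in> {1..k}. median_consistent G (\<mu> i)))"
    (is "(_ \<longleftrightarrow> ?R) \<and> ?consistent")
proof -
  interpret graph G by fact
  let ?M = "{\<mu> \<in> verts G. median_consistent G \<mu>}"
  \<comment> \<open>The second claim comes first because it also yields the backward
    implication.\<close>
  have consistent: ?consistent
    using assms(1) connected_graph.median_consistent_if_C0_C2
    by (metis connected_graph_axioms.intro connected_graph.intro)
  have "?R" if "k_median_graph k G"
  proof -
    obtain T where T: "T \<subseteq> ?M" "card T = k" "finite T"
      using \<open>k_median_graph k G\<close> obtain_subset_with_card_n unfolding k_median_graph_def by metis
    then obtain \<mu> where \<mu>: "bij_betw \<mu> {1..k} T"
      using finite_same_card_bij[of "{1..k}" T] by auto
    then have consistent_\<mu>: "\<mu> i \<in> verts G \<and> median_consistent G (\<mu> i)" if "i \<in> {1..k}" for i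
      using T(1) that bij_betwE by blast
    \<comment> \<open>Here \<open>k \<ge> 1\<close> matters: one median-consistent vertex already
      gives connectedness and bipartiteness.\<close>
    then have \<mu>1: "median_consistent G (\<mu> 1)" using \<open>k \<ge> 1\<close> by simp
    then interpret connected_graph G
      by unfold_locales (rule connected_if_median_consistent)
    have "bipartite G" using \<mu>1 by (rule bipartite_if_median_consistent)
    with consistent_\<mu> show ?R
      using connected bij_betw_imp_inj_on[OF \<mu>]
      by (blast intro: C0_if_median_consistent C2_if_median_consistent)
  qed
  moreover have "k_median_graph k G" if R: ?R
  proof -
    from R obtain \<mu> :: "nat \<Rightarrow> 'a" where \<mu>: "inj_on \<mu> {1..k}" "\<mu> ` {1..k} \<subseteq> ?M"
      using consistent by (metis (no_types, lifting) image_subsetI mem_Collect_eq)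
    have "card (\<mu> ` {1..k}) \<le> card ?M" using \<mu>(2) by (intro card_mono) auto
    with \<mu>(1) show ?thesis by (simp add: k_median_graph_def card_image)
  qed
  ultimately show ?thesis using consistent by blast
qed

end
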